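(* Let $(V,\omega,q)$ be a finite-dimensional dg $(-1)$-shifted symplectic vector space. The space of strict cyclic special deformation retracts on $V$ whose homotopy operator $k$ satisfies $qkq=q$ (i.e. strict retracts onto cohomology) is contractible to a point.
   Context: $|\cdot|$ denotes degree. A $(-1)$-shifted symplectic vector space is a $\mathbb Z$-graded real vector space with an antisymmetric non-degenerate pairing $\omega$ of degree $-1$ (vanishing on arguments of total degree $\neq1$); it is dg if it has a degree $1$ differential $q$ with $\omega(qv,w)+(-1)^{|v|}\omega(v,qw)=0$. The adjoint is defined by $\omega(Ov,w)=(-1)^{|O||v|}\omega(v,O^\dagger w)$. A cyclic special deformation retract from $V$ to a dg $(-1)$-shifted symplectic space $U$ consists of degree $0$ chain maps $p:V\to U$, $i:U\to V$ and a degree $-1$ map $k:V\to V$ (homotopy operator) with $1_V-ip=kq+qk$, $pi=1_U$, $k^2=0$, $pk=0$, $ki=0$, $k^\dagger=k$, $i^\dagger=p$. It is strict if $U$ is a symplectic subspace of $V$, $i$ the inclusion and $p$ the orthogonal projection. A strict cyclic retract is determined by $k$, and the possible $k$ are exactly the degree $-1$ self-adjoint linear maps with $k^2=0$ and $kqk=k$. The space in question is thus the set of degree $-1$ linear maps $k:V\to V$ with $k^\dagger=k$, $k^2=0$, $kqk=k$, $qkq=q$, topologized as a subspace of the finite-dimensional vector space of linear endomorphisms of $V$. *)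

theory Defs
  imports "HOL-Analysis.Analysis"
begin

text \<open>
  Graded vector spaces are subspaces \<open>S\<close> of an ambient real vector space, together with the family
  \<open>V\<close> of their homogeneous parts. Linear and bilinear maps on \<open>S\<close> are given by maps on the ambient
  space of which only the values on \<open>S\<close> matter; this is no restriction, since every linear map on a
  subspace extends.
\<close>

definition graded_space :: "'a::real_vector set \<Rightarrow> (int \<Rightarrow> 'a set) \<Rightarrow> bool" where
  "graded_space S V \<longleftrightarrow>
     subspace S \<and> (\<forall>n. subspace (V n) \<and> V n \<subseteq> S) \<and>
     (\<forall>v\<in>S. \<exists>!c. (\<forall>n. c n \<in> V n) \<and> finite {n. c n \<noteq> 0} \<and> v = (\<Sum>n | c n \<noteq> 0. c n))"

definition finite_dimensional :: "'a::real_vector set \<Rightarrow> bool" where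
  "finite_dimensional S \<longleftrightarrow> (\<exists>B. finite B \<and> span B = S)"

definition has_degree ::
  "int \<Rightarrow> (int \<Rightarrow> 'a set) \<Rightarrow> (int \<Rightarrow> 'b set) \<Rightarrow> ('a \<Rightarrow> 'b) \<Rightarrow> bool" where
  "has_degree d V W f \<longleftrightarrow> (\<forall>n. \<forall>v\<in>V n. f v \<in> W (n + d))"

text \<open>
  Antisymmetry carries no Koszul sign: \<open>\<omega> v w\<close> can be nonzero only if
  \<open>\<bar>v\<bar> + \<bar>w\<bar> = 1\<close>, and then \<open>\<bar>v\<bar>\<bar>w\<bar>\<close> is even.
\<close>

definition shifted_symplectic ::
  "'a::real_vector set \<Rightarrow> (int \<Rightarrow> 'a set) \<Rightarrow> ('a \<Rightarrow> 'a \<Rightarrow> real) \<Rightarrow> bool" where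
  "shifted_symplectic S V \<omega> \<longleftrightarrow>
     graded_space S V \<and> bilinear \<omega> \<and>
     (\<forall>v\<in>S. \<forall>w\<in>S. \<omega> v w = - \<omega> w v) \<and>
     (\<forall>v\<in>S. (\<forall>w\<in>S. \<omega> v w = 0) \<longrightarrow> v = 0) \<and>
     (\<forall>m n. m + n \<noteq> 1 \<longrightarrow> (\<forall>v\<in>V m. \<forall>w\<in>V n. \<omega> v w = 0))"

definition dg_shifted_symplectic ::
  "'a::real_vector set \<Rightarrow> (int \<Rightarrow> 'a set) \<Rightarrow> ('a \<Rightarrow> 'a \<Rightarrow> real) \<Rightarrow> ('a \<Rightarrow> 'a) \<Rightarrow> bool" where
  "dg_shifted_symplectic S V \<omega> q \<longleftrightarrow>
     shifted_symplectic S V \<omega> \<and> linear q \<and> has_degree 1 V V q \<and>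
     (\<forall>v\<in>S. q (q v) = 0) \<and>
     (\<forall>n. \<forall>v\<in>V n. \<forall>w\<in>S. \<omega> (q v) w + (-1) powi n * \<omega> v (q w) = 0)"

text \<open>\<open>is_adjoint d V \<omega> S' \<omega>' f g\<close>: the map \<open>f\<close> of degree \<open>d\<close> from the space graded by \<open>V\<close>
  to \<open>S'\<close> has the adjoint \<open>g\<close>.\<close>

definition is_adjoint ::
  "int \<Rightarrow> (int \<Rightarrow> 'a set) \<Rightarrow> ('a \<Rightarrow> 'a \<Rightarrow> real) \<Rightarrow> 'b set \<Rightarrow> ('b \<Rightarrow> 'b \<Rightarrow> real) \<Rightarrow>
   ('a \<Rightarrow> 'b) \<Rightarrow> ('b \<Rightarrow> 'a) \<Rightarrow> bool" where
  "is_adjoint d V \<omega> S' \<omega>' f g \<longleftrightarrow>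
     (\<forall>n. \<forall>v\<in>V n. \<forall>w\<in>S'. \<omega>' (f v) w = (-1) powi (d * n) * \<omega> v (g w))"

definition cyclic_sdr ::
  "'a::real_vector set \<Rightarrow> (int \<Rightarrow> 'a set) \<Rightarrow> ('a \<Rightarrow> 'a \<Rightarrow> real) \<Rightarrow> ('a \<Rightarrow> 'a) \<Rightarrow>
   'b::real_vector set \<Rightarrow> (int \<Rightarrow> 'b set) \<Rightarrow> ('b \<Rightarrow> 'b \<Rightarrow> real) \<Rightarrow> ('b \<Rightarrow> 'b) \<Rightarrow>
   ('a \<Rightarrow> 'b) \<Rightarrow> ('b \<Rightarrow> 'a) \<Rightarrow> ('a \<Rightarrow> 'a) \<Rightarrow> bool" where
  "cyclic_sdr S V \<omega> q S' V' \<omega>' q' p i k \<longleftrightarrow>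
     dg_shifted_symplectic S V \<omega> q \<and> dg_shifted_symplectic S' V' \<omega>' q' \<and>
     linear p \<and> has_degree 0 V V' p \<and> (\<forall>v\<in>S. p (q v) = q' (p v)) \<and>
     linear i \<and> has_degree 0 V' V i \<and> (\<forall>u\<in>S'. i (q' u) = q (i u)) \<and>
     linear k \<and> has_degree (-1) V V k \<and>
     (\<forall>v\<in>S. v - i (p v) = k (q v) + q (k v)) \<and>
     (\<forall>u\<in>S'. p (i u) = u) \<and>
     (\<forall>v\<in>S. k (k v) = 0) \<and>
     (\<forall>v\<in>S. p (k v) = 0) \<and>
     (\<forall>u\<in>S'. k (i u) = 0) \<and>
     is_adjoint (-1) V \<omega> S \<omega> k k \<and>
     is_adjoint 0 V' \<omega>' S \<omega> i p"

definition orthogonal_projection ::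
  "'a::real_vector set \<Rightarrow> ('a \<Rightarrow> 'a \<Rightarrow> real) \<Rightarrow> 'a set \<Rightarrow> ('a \<Rightarrow> 'a) \<Rightarrow> bool" where
  "orthogonal_projection S \<omega> U p \<longleftrightarrow>
     (\<forall>v\<in>S. p v \<in> U \<and> (\<forall>u\<in>U. \<omega> (v - p v) u = 0))"

definition strict_cyclic_sdr ::
  "'a::real_vector set \<Rightarrow> (int \<Rightarrow> 'a set) \<Rightarrow> ('a \<Rightarrow> 'a \<Rightarrow> real) \<Rightarrow> ('a \<Rightarrow> 'a) \<Rightarrow>
   'a set \<Rightarrow> ('a \<Rightarrow> 'a) \<Rightarrow> ('a \<Rightarrow> 'a) \<Rightarrow> bool" where
  "strict_cyclic_sdr S V \<omega> q U p k \<longleftrightarrow>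
     U \<subseteq> S \<and> cyclic_sdr S V \<omega> q U (\<lambda>n. U \<inter> V n) \<omega> q p (\<lambda>u. u) k \<and>
     orthogonal_projection S \<omega> U p"

text \<open>
  A strict retract is determined by \<open>k\<close>, so the space of strict retracts is the space of their
  homotopy operators. If \<open>'a\<close> is finite-dimensional, every linear endomorphism is bounded and the
  operator norm induces the unique Hausdorff vector space topology on endomorphisms, whichever norm
  \<open>'a\<close> carries. Here \<open>'a\<close> is a normed type instead of a Euclidean space to admit dimension 0.
\<close>

definition strict_cohomology_retracts ::
  "(int \<Rightarrow> 'a::real_normed_vector set) \<Rightarrow> ('a \<Rightarrow> 'a \<Rightarrow> real) \<Rightarrow> ('a \<Rightarrow> 'a) \<Rightarrow> ('a \<Rightarrow>\<^sub>L 'a) set" where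
  "strict_cohomology_retracts V \<omega> q =
     {k. (\<exists>U p. strict_cyclic_sdr UNIV V \<omega> q U p (blinfun_apply k)) \<and>
         (\<forall>v. q (blinfun_apply k (q v)) = q v)}"

lemma graded_space_UNIV_induct:
  assumes g: "graded_space UNIV V"
    and hom: "\<And>n v. v \<in> V n \<Longrightarrow> P v"
    and zero: "P 0" and add: "\<And>v w. P v \<Longrightarrow> P w \<Longrightarrow> P (v + w)"
  shows "P v"
proof -
  obtain c where c: "\<forall>n. c n \<in> V n" "finite {n. c n \<noteq> 0}" "v = (\<Sum>n | c n \<noteq> 0. c n)"
    using g unfolding graded_space_def by blast
  have "P (\<Sum>n\<in>A. c n)" if "finite A" for A
    using that by (induction A rule: finite_induct) (auto intro: zero add hom c(1)[rule_format])
  then show ?thesis using c by metis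
qed

lemma strict_cyclic_sdr_determined:
  assumes "strict_cyclic_sdr UNIV V \<omega> q U p k"
  shows "p = (\<lambda>v. v - k (q v) - q (k v))" and "U = range p"
proof -
  show "p = (\<lambda>v. v - k (q v) - q (k v))"
  proof
    fix v
    have eq: "v - p v = k (q v) + q (k v)"
      using assms unfolding strict_cyclic_sdr_def cyclic_sdr_def by blast
    have "p v = v - (v - p v)" by simp
    also have "\<dots> = v - k (q v) - q (k v)" by (simp only: eq diff_diff_add)
    finally show "p v = v - k (q v) - q (k v)" .
  qed
  have "p v \<in> U" for v
    using assms unfolding strict_cyclic_sdr_def orthogonal_projection_def by blast
  moreover have "p u = u" if "u \<in> U" for u
    using assms that unfolding strict_cyclic_sdr_def cyclic_sdr_def by blast
  ultimately show "U = range p" by (metis image_subset_iff rangeI subsetI subset_antisym)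
qed

lemma strict_cyclic_sdr_exists_iff:
  assumes dg: "dg_shifted_symplectic UNIV V \<omega> q"
  shows "(\<exists>U p. strict_cyclic_sdr UNIV V \<omega> q U p k) \<longleftrightarrow>
     linear k \<and> has_degree (-1) V V k \<and> is_adjoint (-1) V \<omega> UNIV \<omega> k k \<and>
     (\<forall>v. k (k v) = 0) \<and> (\<forall>v. k (q (k v)) = k v)"
    (is "?L \<longleftrightarrow> ?R")
proof
  assume ?L
  then obtain U p where s: "strict_cyclic_sdr UNIV V \<omega> q U p k" by blast
  have p: "p v = v - k (q v) - q (k v)" for v
    using strict_cyclic_sdr_determined(1)[OF s] by metis
  have "p (k v) = 0" "k (k v) = 0" "linear k" for v
    using s unfolding strict_cyclic_sdr_def cyclic_sdr_def by blast+
  moreover have "linear q" using dg by (simp add: dg_shifted_symplectic_def)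
  ultimately have "k (q (k v)) = k v" for v using p[of "k v"] by (simp add: linear_0)
  then show ?R using s by (simp add: strict_cyclic_sdr_def cyclic_sdr_def)
next
  assume R: ?R
  define p where "p = (\<lambda>v. v - k (q v) - q (k v))"
  define U where "U = range p"
  have k: "linear k" "\<And>v. k (k v) = 0" "\<And>v. k (q (k v)) = k v" using R by auto
  have q: "linear q" "\<And>v. q (q v) = 0" using dg by (auto simp: dg_shifted_symplectic_def)
  have S: "shifted_symplectic UNIV V \<omega>" using dg by (simp add: dg_shifted_symplectic_def)
  have G: "graded_space UNIV V" using S by (simp add: shifted_symplectic_def)
  have sub: "subspace (V n)" for n using G by (simp add: graded_space_def)
  have bil: "bilinear \<omega>" using S by (simp add: shifted_symplectic_def)
  have kd: "k v \<in> V (n - 1)" if "v \<in> V n" for n v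
    using R that by (auto simp: has_degree_def)
  have qd: "q v \<in> V (n + 1)" if "v \<in> V n" for n v
    using dg that by (auto simp: dg_shifted_symplectic_def has_degree_def)
  have linp: "linear p" unfolding p_def
    by (intro linear_compose_sub k q linear_ident linear_compose[OF q(1) k(1), unfolded o_def]
        linear_compose[OF k(1) q(1), unfolded o_def])
  note ls = linear_diff[OF k(1)] linear_diff[OF q(1)] linear_0[OF k(1)] linear_0[OF q(1)]
  have pk: "p (k v) = 0" for v by (simp add: p_def k ls)
  have kp: "k (p v) = 0" for v by (simp add: p_def k ls)
  have pq: "p (q v) = q (p v)" for v by (simp add: p_def q ls)
  have pp: "p (p v) = p v" for v
  proof -
    have "k (q (p v)) = 0" using kp[of "q v"] by (simp only: pq)
    moreover have "p (p v) = p v - k (q (p v)) - q (k (p v))" by (simp only: p_def)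
    ultimately show ?thesis by (simp add: kp ls)
  qed
  have pd: "p v \<in> V n" if "v \<in> V n" for n v
    unfolding p_def using kd[OF qd[OF that]] qd[OF kd[OF that]] that
    by (auto intro!: subspace_diff[OF sub])
  have qadj: "\<omega> (q v) w = - ((-1) powi n * \<omega> v (q w))" if "v \<in> V n" for n v w
    using dg that by (auto simp: dg_shifted_symplectic_def eq_neg_iff_add_eq_0)
  have kadj: "\<omega> (k v) w = (-1) powi n * \<omega> v (k w)" if "v \<in> V n" for n v w
    using R that by (auto simp: is_adjoint_def power_int_minus_one_minus)
  have padj_hom: "\<omega> (p v) w = \<omega> v (p w)" if "v \<in> V n" for n v w
  proof -
    have "\<omega> (k (q v)) w = \<omega> v (q (k w))"
      using kadj[OF qd[OF that], of w] qadj[OF that, of "k w"]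
      by (simp add: power_int_add)
    moreover have "\<omega> (q (k v)) w = \<omega> v (k (q w))"
      using qadj[OF kd[OF that], of w] kadj[OF that, of "q w"]
      by (simp add: power_int_diff)
    ultimately show ?thesis
      by (simp add: p_def bilinear_lsub[OF bil] bilinear_rsub[OF bil])
  qed
  have padj: "\<omega> (p v) w = \<omega> v (p w)" for v w
  proof (rule graded_space_UNIV_induct[OF G, of "\<lambda>v. \<omega> (p v) w = \<omega> v (p w)"])
    show "\<omega> (p (v + v')) w = \<omega> (v + v') (p w)"
      if "\<omega> (p v) w = \<omega> v (p w)" "\<omega> (p v') w = \<omega> v' (p w)" for v v'
      using that by (simp only: linear_add[OF linp] bilinear_ladd[OF bil])
  qed (simp_all only: padj_hom linear_0[OF linp] bilinear_lzero[OF bil])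
  have Ufix: "p u = u" if "u \<in> U" for u using that pp by (auto simp: U_def)
  have subU: "subspace U" unfolding U_def using linear_subspace_image[OF linp subspace_UNIV] .
  have "\<exists>!c. (\<forall>n. c n \<in> U \<inter> V n) \<and> finite {n. c n \<noteq> 0} \<and> u = (\<Sum>n | c n \<noteq> 0. c n)"
    if "u \<in> U" for u
  proof -
    have ex1: "\<exists>!c. (\<forall>n. c n \<in> V n) \<and> finite {n. c n \<noteq> 0} \<and> u = (\<Sum>n | c n \<noteq> 0. c n)"
      using G by (simp add: graded_space_def)
    then obtain c where c: "\<forall>n. c n \<in> V n" "finite {n. c n \<noteq> 0}" "u = (\<Sum>n | c n \<noteq> 0. c n)"
      by blast
    define d where "d = (\<lambda>n. p (c n))"
    have sub': "{n. d n \<noteq> 0} \<subseteq> {n. c n \<noteq> 0}" by (auto simp: d_def linear_0[OF linp])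
    have "u = p (\<Sum>n | c n \<noteq> 0. c n)" using c(3) Ufix[OF that] by simp
    also have "\<dots> = (\<Sum>n | c n \<noteq> 0. d n)" by (simp add: d_def linear_sum[OF linp])
    also have "\<dots> = (\<Sum>n | d n \<noteq> 0. d n)"
      by (rule sum.mono_neutral_right[OF c(2) sub']) auto
    finally have "u = (\<Sum>n | d n \<noteq> 0. d n)" .
    then have "(\<forall>n. d n \<in> U \<inter> V n) \<and> finite {n. d n \<noteq> 0} \<and> u = (\<Sum>n | d n \<noteq> 0. d n)"
      using finite_subset[OF sub' c(2)] c(1) pd by (auto simp: d_def U_def)
    moreover have "c' = d" if "(\<forall>n. c' n \<in> U \<inter> V n) \<and> finite {n. c' n \<noteq> 0} \<and>
        u = (\<Sum>n | c' n \<noteq> 0. c' n)" for c'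
      using ex1 that calculation by blast
    ultimately show ?thesis by blast
  qed
  then have GU: "graded_space U (\<lambda>n. U \<inter> V n)"
    unfolding graded_space_def using subU sub by (auto intro: subspace_inter)
  have nondeg: "u = 0" if u: "u \<in> U" "\<And>w. w \<in> U \<Longrightarrow> \<omega> u w = 0" for u
  proof -
    have "\<omega> u w = 0" for w
      using padj[of u w] u(2)[of "p w"] Ufix[OF u(1)] by (simp add: U_def)
    then show ?thesis using S unfolding shifted_symplectic_def by blast
  qed
  have SU: "shifted_symplectic U (\<lambda>n. U \<inter> V n) \<omega>"
    unfolding shifted_symplectic_def
  proof (intro conjI ballI impI allI)
    show "\<omega> v w = - \<omega> w v" for v w using S unfolding shifted_symplectic_def by blast
    show "\<omega> v w = 0" if "m + n \<noteq> 1" "v \<in> U \<inter> V m" "w \<in> U \<inter> V n" for m n v w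
      using S that unfolding shifted_symplectic_def by blast
    show "v = 0" if "v \<in> U" "\<forall>w\<in>U. \<omega> v w = 0" for v using nondeg that by blast
  qed (fact GU bil)+
  have qU: "q u \<in> U" if "u \<in> U" for u
    using pq[of u] Ufix[OF that] by (metis U_def rangeI)
  have dgU: "dg_shifted_symplectic U (\<lambda>n. U \<inter> V n) \<omega> q"
    unfolding dg_shifted_symplectic_def
  proof (intro conjI ballI allI)
    show "has_degree 1 (\<lambda>n. U \<inter> V n) (\<lambda>n. U \<inter> V n) q"
      using qd qU by (simp add: has_degree_def)
    show "\<omega> (q v) w + (-1) powi n * \<omega> v (q w) = 0" if "v \<in> U \<inter> V n" for n v w
      using qadj[of v n w] that by simp
  qed (simp_all only: SU q simp_thms)
  have kU: "k u = 0" if "u \<in> U" for u using kp Ufix[OF that] by metis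
  have "has_degree 0 V (\<lambda>n. U \<inter> V n) p" "has_degree 0 (\<lambda>n. U \<inter> V n) V (\<lambda>u. u)"
    using pd by (simp_all add: has_degree_def U_def)
  moreover have "v - p v = k (q v) + q (k v)" for v by (simp add: p_def)
  moreover have "is_adjoint 0 (\<lambda>n. U \<inter> V n) \<omega> UNIV \<omega> (\<lambda>u. u) p"
    unfolding is_adjoint_def
  proof (intro allI ballI)
    fix n u w assume "u \<in> U \<inter> V n"
    then show "\<omega> u w = (-1) powi (0 * n) * \<omega> u (p w)"
      using padj[of u w] Ufix[of u] by simp
  qed
  ultimately have "cyclic_sdr UNIV V \<omega> q U (\<lambda>n. U \<inter> V n) \<omega> q p (\<lambda>u. u) k"
    unfolding cyclic_sdr_def using dg dgU linp pq R Ufix pk kU linear_ident by blast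
  moreover have "orthogonal_projection UNIV \<omega> U p"
    unfolding orthogonal_projection_def
  proof (intro ballI conjI)
    show "p v \<in> U" for v by (simp add: U_def)
    show "\<omega> (v - p v) u = 0" if "u \<in> U" for u v
      using padj[of v u] Ufix[OF that] by (simp add: bilinear_lsub[OF bil])
  qed
  ultimately show ?L unfolding strict_cyclic_sdr_def by blast
qed

lemma strict_cohomology_retracts_eq:
  assumes "dg_shifted_symplectic UNIV V \<omega> q"
  shows "strict_cohomology_retracts V \<omega> q =
    {k. has_degree (-1) V V (blinfun_apply k) \<and>
        is_adjoint (-1) V \<omega> UNIV \<omega> (blinfun_apply k) (blinfun_apply k) \<and>
        (\<forall>v. k (k v) = 0) \<and> (\<forall>v. k (q (k v)) = k v) \<and> (\<forall>v. q (k (q v)) = q v)}"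
  unfolding strict_cohomology_retracts_def strict_cyclic_sdr_exists_iff[OF assms]
  by (auto simp: bounded_linear.linear blinfun.bounded_linear_right)

end

theory Submission
  imports Defs
begin

text \<open>
  Write \<open>P\<close> for the set of self-adjoint maps \<open>h\<close> of degree \<open>-1\<close> with \<open>qhq = q\<close>, and \<open>R \<subseteq> P\<close> for the
  homotopy operators of strict retracts onto cohomology, which satisfy in addition \<open>k\<^sup>2 = 0\<close> and
  \<open>kqk = k\<close>. The conditions defining \<open>P\<close> are affine, so \<open>P\<close> is convex, and \<open>P\<close> is nonempty: take a
  generalized inverse of \<open>q\<close>, keep its part of degree \<open>-1\<close>, and average it with its adjoint.
  A continuous retraction of \<open>P\<close> onto \<open>R\<close> is given by \<open>h \<mapsto> (1 - qk/2) k (1 - kq/2)\<close>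
  with \<open>k = hqh\<close>; hence \<open>R\<close> is contractible.
\<close>

section \<open>Continuity of linear maps in finite dimension\<close>

lemma finite_dimensional_basis:
  assumes "finite_dimensional (UNIV :: 'a::real_vector set)"
  obtains B :: "'a::real_vector set" where "finite B" "independent B" "span B = UNIV"
proof -
  obtain C :: "'a set" where C: "finite C" "span C = UNIV"
    using assms unfolding finite_dimensional_def by blast
  obtain B where B: "B \<subseteq> C" "independent B" "C \<subseteq> span B"
    by (rule maximal_independent_subset)
  have "span B = UNIV"
    using span_minimal[OF B(3) subspace_span] C(2) by auto
  then show thesis using that B C(1) finite_subset by blast
qed

text \<open>Each basis vector adds a segment to the box, and the sum of two compact sets is
  compact.\<close>

lemma compact_coefficient_box:
  fixes A :: "'a::real_normed_vector set"
  assumes "finite A"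
  shows "compact {(\<Sum>b\<in>A. c b *\<^sub>R b) | c. \<forall>b\<in>A. \<bar>c b\<bar> \<le> (1::real)}"
  using assms
proof (induction A rule: finite_induct)
  case (insert a A)
  let ?K = "\<lambda>A. {(\<Sum>b\<in>A. c b *\<^sub>R b) | c. \<forall>b\<in>A. \<bar>c b\<bar> \<le> (1::real)}"
  let ?I = "(\<lambda>t. t *\<^sub>R a) ` {-1..1::real}"
  have "compact ?I"
    by (intro compact_continuous_image continuous_intros compact_Icc)
  then have "compact {x + y | x y. x \<in> ?I \<and> y \<in> ?K A}"
    using insert.IH by (rule compact_sums)
  moreover have "{x + y | x y. x \<in> ?I \<and> y \<in> ?K A} = ?K (insert a A)"
  proof (intro subset_antisym subsetI)
    fix z assume "z \<in> {x + y | x y. x \<in> ?I \<and> y \<in> ?K A}"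
    then obtain t c where t: "t \<in> {-1..1::real}" and c: "\<forall>b\<in>A. \<bar>c b\<bar> \<le> 1"
      and z: "z = t *\<^sub>R a + (\<Sum>b\<in>A. c b *\<^sub>R b)" by blast
    have "(\<Sum>b\<in>insert a A. (c(a := t)) b *\<^sub>R b) = t *\<^sub>R a + (\<Sum>b\<in>A. (c(a := t)) b *\<^sub>R b)"
      using insert.hyps by simp
    also have "(\<Sum>b\<in>A. (c(a := t)) b *\<^sub>R b) = (\<Sum>b\<in>A. c b *\<^sub>R b)"
      using insert.hyps by (intro sum.cong) auto
    finally have "z = (\<Sum>b\<in>insert a A. (c(a := t)) b *\<^sub>R b)" by (simp only: z)
    moreover have "\<forall>b\<in>insert a A. \<bar>(c(a := t)) b\<bar> \<le> 1" using t c by auto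
    ultimately show "z \<in> ?K (insert a A)" by blast
  next
    fix z assume "z \<in> ?K (insert a A)"
    then obtain c where c: "\<forall>b\<in>insert a A. \<bar>c b\<bar> \<le> 1" "z = (\<Sum>b\<in>insert a A. c b *\<^sub>R b)"
      by blast
    then have "z = c a *\<^sub>R a + (\<Sum>b\<in>A. c b *\<^sub>R b)" using insert.hyps by simp
    moreover have "c a *\<^sub>R a \<in> ?I" using c(1) by (intro imageI) (auto simp: abs_le_iff)
    ultimately show "z \<in> {x + y | x y. x \<in> ?I \<and> y \<in> ?K A}" using c(1) by blast
  qed
  ultimately show ?case by simp
qed simp

text \<open>
  Scaling the largest coordinate to \<open>1\<close> places the vector in a compact set that avoids \<open>0\<close> by
  linear independence.
\<close>

lemma finite_dimensional_coordinate_bound: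
  fixes B :: "'a::real_normed_vector set"
  assumes B: "finite B" "independent B" "span B = UNIV"
  obtains D where "\<And>x b. b \<in> B \<Longrightarrow> \<bar>representation B x b\<bar> \<le> D * norm x"
proof -
  have "\<exists>\<delta>>0. \<forall>c. (\<forall>b\<in>B. \<bar>c b\<bar> \<le> (1::real)) \<longrightarrow> c a = 1 \<longrightarrow> \<delta> \<le> norm (\<Sum>b\<in>B. c b *\<^sub>R b)"
    if a: "a \<in> B" for a
  proof -
    let ?K = "{(\<Sum>b\<in>B - {a}. c b *\<^sub>R b) | c. \<forall>b\<in>B - {a}. \<bar>c b\<bar> \<le> (1::real)}"
    have "compact ((+) a ` ?K)"
      by (intro compact_translation compact_coefficient_box) (simp add: B(1))
    then have closed: "closed ((+) a ` ?K)" by (rule compact_imp_closed)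
    have "0 \<notin> (+) a ` ?K"
    proof
      assume "0 \<in> (+) a ` ?K"
      then obtain c where "0 = a + (\<Sum>b\<in>B - {a}. c b *\<^sub>R b)" by blast
      then have "a = - (\<Sum>b\<in>B - {a}. c b *\<^sub>R b)" by (simp add: eq_neg_iff_add_eq_0)
      moreover have "- (\<Sum>b\<in>B - {a}. c b *\<^sub>R b) \<in> span (B - {a})"
        by (intro span_neg span_sum span_scale span_base)
      ultimately have "a \<in> span (B - {a})" by simp
      then show False using B(2) a by (auto simp: dependent_def)
    qed
    then have "0 \<in> - (+) a ` ?K" by (simp only: Compl_iff not_False_eq_True simp_thms)
    with open_Compl[OF closed] obtain \<delta> where \<delta>: "\<delta> > 0" "ball 0 \<delta> \<subseteq> - (+) a ` ?K"
      by (rule openE)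
    have "\<delta> \<le> norm (\<Sum>b\<in>B. c b *\<^sub>R b)" if c: "\<forall>b\<in>B. \<bar>c b\<bar> \<le> (1::real)" "c a = 1" for c
    proof -
      have "(\<Sum>b\<in>B. c b *\<^sub>R b) = a + (\<Sum>b\<in>B - {a}. c b *\<^sub>R b)"
        using sum.remove[OF B(1) a, of "\<lambda>b. c b *\<^sub>R b"] c(2) by simp
      moreover have "(\<Sum>b\<in>B - {a}. c b *\<^sub>R b) \<in> ?K" using c(1) by blast
      ultimately have "(\<Sum>b\<in>B. c b *\<^sub>R b) \<in> (+) a ` ?K" by (simp only: imageI)
      then have "(\<Sum>b\<in>B. c b *\<^sub>R b) \<notin> ball 0 \<delta>" using subsetD[OF \<delta>(2)] by (meson ComplD)
      then show ?thesis by simp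
    qed
    then show ?thesis using \<delta>(1) by blast
  qed
  then have "\<forall>a\<in>B. \<exists>\<delta>>0. \<forall>c. (\<forall>b\<in>B. \<bar>c b\<bar> \<le> (1::real)) \<longrightarrow> c a = 1 \<longrightarrow>
      \<delta> \<le> norm (\<Sum>b\<in>B. c b *\<^sub>R b)" by (rule ballI)
  from bchoice[OF this] obtain \<delta> where \<delta>: "\<And>a. a \<in> B \<Longrightarrow> \<delta> a > (0::real)"
    "\<And>a c. a \<in> B \<Longrightarrow> (\<forall>b\<in>B. \<bar>c b\<bar> \<le> (1::real)) \<Longrightarrow> c a = 1 \<Longrightarrow> \<delta> a \<le> norm (\<Sum>b\<in>B. c b *\<^sub>R b)"
    by blast
  show thesis
  proof (rule that)
    fix x b assume b: "b \<in> B"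
    let ?r = "representation B x"
    \<comment> \<open>The index of a coordinate of largest absolute value: dividing by this
      coordinate puts all coefficients in \<open>[-1, 1]\<close> and makes the one at
      \<open>a\<close> equal to 1.\<close>
    obtain a where a: "a \<in> B" "\<And>b. b \<in> B \<Longrightarrow> \<bar>?r b\<bar> \<le> \<bar>?r a\<bar>"
    proof -
      have "Max ((\<lambda>b. \<bar>?r b\<bar>) ` B) \<in> (\<lambda>b. \<bar>?r b\<bar>) ` B" using B(1) b by (intro Max_in) auto
      then obtain a where "a \<in> B" "Max ((\<lambda>b. \<bar>?r b\<bar>) ` B) = \<bar>?r a\<bar>" by blast
      moreover have "\<bar>?r c\<bar> \<le> Max ((\<lambda>b. \<bar>?r b\<bar>) ` B)" if "c \<in> B" for c
        using B(1) that by (intro Max_ge) auto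
      ultimately show thesis using that by simp
    qed
    have x: "x = (\<Sum>b\<in>B. ?r b *\<^sub>R b)"
      using real_vector.sum_representation_eq[OF B(2) _ B(1) order_refl, of x] B(3) by simp
    have ra: "\<bar>?r a\<bar> \<le> norm x / \<delta> a"
    proof (cases "?r a = 0")
      case False
      have "\<delta> a \<le> norm (\<Sum>b\<in>B. (?r b / ?r a) *\<^sub>R b)"
        using False a by (intro \<delta>(2)) (auto simp: divide_simps)
      also have "(\<Sum>b\<in>B. (?r b / ?r a) *\<^sub>R b) = (1 / ?r a) *\<^sub>R (\<Sum>b\<in>B. ?r b *\<^sub>R b)"
        by (simp add: scaleR_sum_right)
      also have "\<dots> = (1 / ?r a) *\<^sub>R x" by (simp only: x[symmetric])
      also have "norm \<dots> = norm x / \<bar>?r a\<bar>" by simp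
      finally show ?thesis using False \<delta>(1)[OF a(1)] by (simp add: field_simps)
    qed (use \<delta>(1)[OF a(1)] in simp)
    \<comment> \<open>The index \<open>a\<close> depends on \<open>x\<close>; summing
      \<open>1 / \<delta> b\<close> over the whole basis gives a constant that does not.\<close>
    have "1 / \<delta> a \<le> (\<Sum>b\<in>B. 1 / \<delta> b)"
      using a(1) B(1) \<delta>(1) by (intro member_le_sum) (auto simp: less_imp_le)
    then have "norm x / \<delta> a \<le> (\<Sum>b\<in>B. 1 / \<delta> b) * norm x"
      using mult_right_mono[of "1 / \<delta> a" "\<Sum>b\<in>B. 1 / \<delta> b" "norm x"] by simp
    then show "\<bar>?r b\<bar> \<le> (\<Sum>b\<in>B. 1 / \<delta> b) * norm x"
      using ra a(2)[OF b] by linarith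
  qed
qed

text \<open>The coordinates are bounded by a multiple of the norm, and \<open>f\<close> is
  determined by its values on a finite basis. This lets \<open>q\<close> and a parametrix be treated
  as elements of the normed space of bounded operators.\<close>

lemma linear_finite_dimensional_bounded_linear:
  fixes f :: "'a::real_normed_vector \<Rightarrow> 'b::real_normed_vector"
  assumes fin: "finite_dimensional (UNIV :: 'a set)" and f: "linear f"
  shows "bounded_linear f"
proof -
  obtain B :: "'a set" where B: "finite B" "independent B" "span B = UNIV"
    using finite_dimensional_basis[OF fin] .
  obtain D where D: "\<And>x b. b \<in> B \<Longrightarrow> \<bar>representation B x b\<bar> \<le> D * norm x"
    using finite_dimensional_coordinate_bound[OF B] by blast
  have "norm (f x) \<le> norm x * (D * (\<Sum>b\<in>B. norm (f b)))" for x
  proof -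
    have "f x = f (\<Sum>b\<in>B. representation B x b *\<^sub>R b)"
      using real_vector.sum_representation_eq[OF B(2) _ B(1) order_refl, of x] B(3) by simp
    also have "\<dots> = (\<Sum>b\<in>B. representation B x b *\<^sub>R f b)"
      by (simp add: linear_sum[OF f] linear_cmul[OF f])
    also have "norm \<dots> \<le> (\<Sum>b\<in>B. \<bar>representation B x b\<bar> * norm (f b))"
      by (rule order_trans[OF norm_sum]) simp
    also have "\<dots> \<le> (\<Sum>b\<in>B. (D * norm x) * norm (f b))"
      by (intro sum_mono mult_right_mono D) auto
    finally show ?thesis by (simp add: sum_distrib_left mult_ac)
  qed
  then show ?thesis
    using f by (auto intro!: bounded_linear_intro[where K = "D * (\<Sum>b\<in>B. norm (f b))"]
        simp: linear_add linear_cmul)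
qed

section \<open>Adjoints for a nondegenerate bilinear form\<close>

lemma finite_dimensional_linear_inj_imp_surj:
  fixes f :: "'a::real_vector \<Rightarrow> 'a"
  assumes fin: "finite_dimensional (UNIV :: 'a set)" and f: "linear f" "inj f"
  shows "surj f"
proof -
  obtain B :: "'a set" where B: "finite B" "independent B" "span B = UNIV"
    using finite_dimensional_basis[OF fin] .
  \<comment> \<open>The type carries no Euclidean structure, so dimension theory is instantiated at
    the chosen basis.\<close>
  interpret finite_dimensional_vector_space "scaleR :: real \<Rightarrow> 'a \<Rightarrow> 'a" B
    by unfold_locales (use B in \<open>auto simp: dependent_raw_def span_raw_def\<close>)
  show ?thesis using linear_inj_imp_surj[unfolded linear_def[symmetric]] f by blast
qed

text \<open>\<open>T w\<close> encodes the functional \<open>\<omega> _ w\<close> by its values on a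
  basis. Nondegeneracy makes \<open>T\<close> injective, hence surjective; a linear right inverse
  \<open>g\<close> of \<open>T\<close>, applied to the encoding \<open>S w\<close> of
  \<open>\<omega> (A _) w\<close>, is the adjoint.\<close>

lemma bilinear_adjoint_exists:
  fixes \<omega> :: "'a::real_vector \<Rightarrow> 'a \<Rightarrow> real"
  assumes fin: "finite_dimensional (UNIV :: 'a set)" and bil: "bilinear \<omega>"
    and nondeg: "\<And>w. (\<And>v. \<omega> v w = 0) \<Longrightarrow> w = 0" and A: "linear A"
  obtains A' where "linear A'" "\<And>v w. \<omega> (A v) w = \<omega> v (A' w)"
proof -
  obtain B :: "'a set" where B: "finite B" "independent B" "span B = UNIV"
    using finite_dimensional_basis[OF fin] .
  have lin: "linear (\<omega> v)" "linear (\<lambda>v. \<omega> v w)" for v w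
    using bil by (auto simp: bilinear_def)
  define T where "T w = (\<Sum>b\<in>B. \<omega> b w *\<^sub>R b)" for w
  have T: "linear T" unfolding T_def
    by (rule linearI) (simp_all add: linear_add[OF lin(1)] linear_cmul[OF lin(1)]
        scaleR_add_left sum.distrib scaleR_sum_right)
  have coeff: "f b = g b" if "(\<Sum>b\<in>B. f b *\<^sub>R b) = (\<Sum>b\<in>B. g b *\<^sub>R b)" "b \<in> B" for f g b
  proof -
    have "(\<Sum>b\<in>B. (f b - g b) *\<^sub>R b) = 0"
      using that(1) by (simp add: scaleR_diff_left sum_subtractf)
    then show ?thesis using B(1,2) that(2) independentD[of B B "\<lambda>b. f b - g b" b] by auto
  qed
  have ext: "\<phi> = \<psi>" if "linear \<phi>" "linear \<psi>" "\<And>b. b \<in> B \<Longrightarrow> \<phi> b = \<psi> b" for \<phi> \<psi> :: "'a \<Rightarrow> real"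
    using linear_eq_on[OF that(1,2), of _ B] that(3) B(3) by (simp add: fun_eq_iff)
  have "inj T"
    unfolding linear_injective_0[OF T]
  proof (intro allI impI)
    fix w assume "T w = 0"
    then have "\<omega> b w = 0" if "b \<in> B" for b
      using coeff[of "\<lambda>b. \<omega> b w" "\<lambda>_. 0"] that by (simp add: T_def)
    then have "(\<lambda>v. \<omega> v w) = (\<lambda>_. 0)" by (intro ext lin linear_zero)
    then show "w = 0" using nondeg by meson
  qed
  then have "surj T" using finite_dimensional_linear_inj_imp_surj[OF fin T] by blast
  then obtain g where g: "linear g" "T \<circ> g = id" using linear_surjective_right_inverse[OF T] by blast
  define S where "S w = (\<Sum>b\<in>B. \<omega> (A b) w *\<^sub>R b)" for w
  have S: "linear S" unfolding S_def
    by (rule linearI) (simp_all add: linear_add[OF lin(1)] linear_cmul[OF lin(1)]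
        scaleR_add_left sum.distrib scaleR_sum_right)
  show thesis
  proof (rule that)
    show "linear (g \<circ> S)" using linear_compose[OF S g(1)] .
    fix v w
    have "T ((g \<circ> S) w) = S w" using g(2) by (simp add: fun_eq_iff)
    then have "\<omega> b ((g \<circ> S) w) = \<omega> (A b) w" if "b \<in> B" for b
      unfolding T_def S_def by (rule coeff[OF _ that])
    then have "(\<lambda>v. \<omega> (A v) w) = (\<lambda>v. \<omega> v ((g \<circ> S) w))"
      by (intro ext lin linear_compose[OF A lin(2), unfolded o_def]) simp
    then show "\<omega> (A v) w = \<omega> v ((g \<circ> S) w)" by meson
  qed
qed

section \<open>Homogeneous components and graded generalized inverses\<close>

text \<open>Uniqueness of the decomposition makes each component depend linearly on the vector. A
  finite spanning set involves finitely many degrees, so one finite \<open>N\<close> serves all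
  vectors.\<close>

lemma graded_projections:
  fixes V :: "int \<Rightarrow> 'a::real_vector set"
  assumes fin: "finite_dimensional (UNIV :: 'a set)" and G: "graded_space UNIV V"
  obtains N :: "int set" and \<pi> :: "int \<Rightarrow> 'a \<Rightarrow> 'a" where "finite N" "\<And>n. linear (\<pi> n)"
    "\<And>n v. \<pi> n v \<in> V n" "\<And>m n v. v \<in> V n \<Longrightarrow> \<pi> m v = (if m = n then v else 0)"
    "\<And>v. (\<Sum>n\<in>N. \<pi> n v) = v"
proof -
  have sub: "subspace (V n)" for n using G by (simp add: graded_space_def)
  have "\<forall>v. \<exists>!c. (\<forall>n. c n \<in> V n) \<and> finite {n. c n \<noteq> 0} \<and> v = (\<Sum>n | c n \<noteq> 0. c n)"
    using G by (simp add: graded_space_def)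
  then obtain c where c: "\<And>v n. c v n \<in> V n" "\<And>v. finite {n. c v n \<noteq> 0}"
      "\<And>v. v = (\<Sum>n | c v n \<noteq> 0. c v n)"
    and uniq: "\<And>v d. (\<forall>n. d n \<in> V n) \<and> finite {n. d n \<noteq> 0} \<and> v = (\<Sum>n | d n \<noteq> 0. d n) \<Longrightarrow> d = c v"
    by metis
  \<comment> \<open>Uniqueness in usable form: the index set may be any finite set containing the
    support.\<close>
  have c_eqI: "c v n = d n"
    if "\<And>n. d n \<in> V n" "finite F" "\<And>n. n \<notin> F \<Longrightarrow> d n = 0" "v = (\<Sum>n\<in>F. d n)" for d F v n
  proof -
    have "{n. d n \<noteq> 0} \<subseteq> F" using that(3) by blast
    moreover from this have "(\<Sum>n\<in>F. d n) = (\<Sum>n | d n \<noteq> 0. d n)"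
      by (intro sum.mono_neutral_right[OF that(2)]) auto
    ultimately have "d = c v"
      using uniq[of d v] that finite_subset by (smt (verit))
    then show ?thesis by simp
  qed
  have c_sum: "v = (\<Sum>n\<in>F. c v n)" if "finite F" "{n. c v n \<noteq> 0} \<subseteq> F" for v F
  proof -
    have "(\<Sum>n\<in>F. c v n) = (\<Sum>n | c v n \<noteq> 0. c v n)"
      by (intro sum.mono_neutral_right that) auto
    then show ?thesis using c(3)[of v] by simp
  qed
  have add: "c (v + w) n = c v n + c w n" for v w n
  proof (rule c_eqI)
    let ?F = "{n. c v n \<noteq> 0} \<union> {n. c w n \<noteq> 0}"
    show "finite ?F" using c(2) by blast
    then have "v = (\<Sum>n\<in>?F. c v n)" "w = (\<Sum>n\<in>?F. c w n)" by (intro c_sum; blast)+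
    then show "v + w = (\<Sum>n\<in>?F. c v n + c w n)" by (simp add: sum.distrib)
  qed (use c(1) in \<open>auto intro: subspace_add[OF sub]\<close>)
  have scale: "c (r *\<^sub>R v) n = r *\<^sub>R c v n" for r v n
    by (rule c_eqI[where F = "{n. c v n \<noteq> 0}"])
      (use c in \<open>auto intro: subspace_scale[OF sub] simp: scaleR_sum_right[symmetric]\<close>)
  define \<pi> where "\<pi> n v = c v n" for n v
  have lin: "linear (\<pi> n)" for n by (rule linearI) (simp_all add: \<pi>_def add scale)
  obtain B :: "'a set" where B: "finite B" "span B = UNIV"
    using fin unfolding finite_dimensional_def by blast
  define N where "N = (\<Union>b\<in>B. {n. c b n \<noteq> 0})"
  have N: "finite N" using B c(2) by (simp add: N_def)
  have "c v n = 0" if "n \<notin> N" for v n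
    using linear_eq_on[OF lin[of n] linear_zero, of v B] B(2) that by (auto simp: N_def \<pi>_def)
  then have "(\<Sum>n\<in>N. \<pi> n v) = v" for v
    unfolding \<pi>_def by (intro c_sum[symmetric] N) blast
  moreover have "\<pi> m v = (if m = n then v else 0)" if "v \<in> V n" for m n v
    unfolding \<pi>_def
    by (rule c_eqI[where F = "{n}"]) (use that in \<open>auto intro: subspace_0[OF sub]\<close>)
  ultimately show thesis using that N lin c(1) by (metis \<pi>_def)
qed

text \<open>These facts are cited below by position as \<open>D(i)\<close>. Antisymmetry moves
  nondegeneracy to the second argument.\<close>

lemma dg_shifted_symplectic_UNIV_D:
  assumes dg: "dg_shifted_symplectic UNIV V \<omega> q"
  shows "graded_space UNIV V" "bilinear \<omega>" "\<omega> v w = - \<omega> w v"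
    "(\<And>v. \<omega> v w = 0) \<Longrightarrow> w = 0" "x \<in> V m \<Longrightarrow> y \<in> V n \<Longrightarrow> m + n \<noteq> 1 \<Longrightarrow> \<omega> x y = 0"
    "linear q" "q (q v) = 0" "x \<in> V n \<Longrightarrow> q x \<in> V (n + 1)"
    "x \<in> V n \<Longrightarrow> \<omega> (q x) w = - ((-1) powi n * \<omega> x (q w))"
proof -
  have S: "shifted_symplectic UNIV V \<omega>" using dg by (simp add: dg_shifted_symplectic_def)
  show "graded_space UNIV V" "bilinear \<omega>" using S by (simp_all add: shifted_symplectic_def)
  show anti: "\<omega> v w = - \<omega> w v" for v w using S unfolding shifted_symplectic_def by blast
  show "w = 0" if "\<And>v. \<omega> v w = 0"
  proof -
    have "\<omega> w v = 0" for v using anti[of w v] that by simp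
    then show ?thesis using S unfolding shifted_symplectic_def by blast
  qed
  show "\<omega> x y = 0" if "x \<in> V m" "y \<in> V n" "m + n \<noteq> 1"
    using S that unfolding shifted_symplectic_def by blast
  show "linear q" "q (q v) = 0" using dg by (auto simp: dg_shifted_symplectic_def)
  show "q x \<in> V (n + 1)" if "x \<in> V n"
    using dg that by (auto simp: dg_shifted_symplectic_def has_degree_def)
  show "\<omega> (q x) w = - ((-1) powi n * \<omega> x (q w))" if "x \<in> V n"
    using dg that by (auto simp: dg_shifted_symplectic_def eq_neg_iff_add_eq_0)
qed

text \<open>The part of degree -1 of an ungraded generalized inverse is still one, because
  \<open>q\<close> intertwines the projection to degree \<open>n\<close> with that to degree
  \<open>n + 1\<close>.\<close>

lemma graded_right_inverse:
  assumes fin: "finite_dimensional (UNIV :: 'a::real_vector set)" and G: "graded_space UNIV V"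
    and q: "linear q" "has_degree 1 V V (q :: 'a \<Rightarrow> 'a)"
  obtains h where "linear h" "has_degree (-1) V V h" "\<And>v. q (h (q v)) = q v"
proof -
  obtain N \<pi> where N: "finite N" and \<pi>: "\<And>n. linear (\<pi> n)" "\<And>n v. \<pi> n v \<in> V n"
      "\<And>m n v. v \<in> V n \<Longrightarrow> \<pi> m v = (if m = n then v else 0)" "\<And>v. (\<Sum>n\<in>N. \<pi> n v) = v"
    using graded_projections[OF fin G] by blast
  have sub: "subspace (V n)" for n using G by (simp add: graded_space_def)
  have qd: "q v \<in> V (n + 1)" if "v \<in> V n" for n v using q(2) that by (auto simp: has_degree_def)
  \<comment> \<open>A right inverse of \<open>q\<close> on its range, with no control of
    degrees.\<close>
  obtain g where g: "linear g" "\<And>v. q (g (q v)) = q v"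
    using linear_exists_right_inverse_on[OF q(1) subspace_UNIV] by auto
  define h where "h v = (\<Sum>n\<in>N. \<pi> (n - 1) (g (\<pi> n v)))" for v
  have "linear (\<lambda>v. \<pi> (n - 1) (g (\<pi> n v)))" for n
    using linear_compose[OF linear_compose[OF \<pi>(1)[of n] g(1)] \<pi>(1)[of "n - 1"]] by (simp add: o_def)
  then have lin: "linear h" unfolding h_def by (rule linear_compose_sum[OF ballI])
  have hv: "h v = \<pi> (n - 1) (g v)" if v: "v \<in> V n" for n v
  proof -
    have "h v = (\<Sum>m\<in>N. if m = n then \<pi> (n - 1) (g v) else 0)"
      unfolding h_def using \<pi>(3)[OF v] by (intro sum.cong) (auto simp: linear_0[OF g(1)] linear_0[OF \<pi>(1)])
    also have "\<dots> = (if n \<in> N then \<pi> (n - 1) (g v) else 0)" using N by simp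
    \<comment> \<open>In a degree outside \<open>N\<close> the vector \<open>v\<close> is the sum of
      its vanishing components, so it is 0.\<close>
    also have "\<dots> = \<pi> (n - 1) (g v)"
    proof (cases "n \<in> N")
      case False
      have "v = (\<Sum>m\<in>N. \<pi> m v)" by (rule \<pi>(4)[symmetric])
      also have "\<dots> = 0" using \<pi>(3)[OF v] False by (intro sum.neutral) auto
      finally show ?thesis by (simp add: linear_0[OF g(1)] linear_0[OF \<pi>(1)])
    qed simp
    finally show ?thesis .
  qed
  have q\<pi>: "q (\<pi> n v) = \<pi> (n + 1) (q v)" for n v
  proof (rule graded_space_UNIV_induct[OF G, of "\<lambda>v. q (\<pi> n v) = \<pi> (n + 1) (q v)"])
    show "q (\<pi> n v) = \<pi> (n + 1) (q v)" if "v \<in> V m" for m v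
      using \<pi>(3)[OF that] \<pi>(3)[OF qd[OF that]] by (simp add: linear_0[OF q(1)])
  qed (simp_all add: linear_0[OF q(1)] linear_0[OF \<pi>(1)] linear_add[OF q(1)] linear_add[OF \<pi>(1)])
  show thesis
  proof (rule that[OF lin])
    show "has_degree (-1) V V h" using \<pi>(2) by (simp add: has_degree_def hv)
    show "q (h (q v)) = q v" for v
    proof (rule graded_space_UNIV_induct[OF G, of "\<lambda>v. q (h (q v)) = q v"])
      show "q (h (q v)) = q v" if "v \<in> V n" for n v
        using \<pi>(3)[OF qd[OF that]] hv[OF qd[OF that]] q\<pi>[of n "g (q v)"] g(2) by simp
    qed (simp_all add: linear_0[OF q(1)] linear_0[OF lin] linear_add[OF q(1)] linear_add[OF lin])
  qed
qed

section \<open>Graded adjoints\<close>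

text \<open>The component of \<open>w\<close> in a degree \<open>m\<close> other than
  \<open>n\<close> pairs only with vectors of degree \<open>1 - m\<close>, and on those it pairs as
  \<open>w\<close> does, namely to 0. Nondegeneracy removes it. This yields the degree of an
  adjoint.\<close>

lemma nondegenerate_homogeneous:
  assumes fin: "finite_dimensional (UNIV :: 'a::real_vector set)"
    and dg: "dg_shifted_symplectic UNIV V \<omega> (q :: 'a \<Rightarrow> 'a)"
    and w: "\<And>v m. v \<in> V m \<Longrightarrow> m \<noteq> 1 - n \<Longrightarrow> \<omega> v w = 0"
  shows "w \<in> V n"
proof -
  note D = dg_shifted_symplectic_UNIV_D[OF dg]
  have lin: "linear (\<omega> v)" "linear (\<lambda>v. \<omega> v x)" for v x
    using D(2) by (auto simp: bilinear_def)
  obtain N \<pi> where N: "finite N" and \<pi>: "\<And>n. linear (\<pi> n)" "\<And>n v. \<pi> n v \<in> V n"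
      "\<And>m n v. v \<in> V n \<Longrightarrow> \<pi> m v = (if m = n then v else 0)" "\<And>v. (\<Sum>n\<in>N. \<pi> n v) = v"
    using graded_projections[OF fin D(1)] by blast
  have "\<pi> m w = 0" if "m \<in> N" "m \<noteq> n" for m
  proof (rule D(4))
    show "\<omega> v (\<pi> m w) = 0" for v
    proof (rule graded_space_UNIV_induct[OF D(1), of "\<lambda>v. \<omega> v (\<pi> m w) = 0"])
      show "\<omega> v (\<pi> m w) = 0" if v: "v \<in> V l" for l v
      proof (cases "l = 1 - m")
        case True
        have "\<omega> v w = \<omega> v (\<Sum>i\<in>N. \<pi> i w)" by (simp only: \<pi>(4))
        also have "\<dots> = (\<Sum>i\<in>N. \<omega> v (\<pi> i w))" by (rule linear_sum[OF lin(1)])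
        also have "\<dots> = (\<Sum>i\<in>N. if i = m then \<omega> v (\<pi> m w) else 0)"
          using D(5)[OF v \<pi>(2)] True by (intro sum.cong) auto
        also have "\<dots> = \<omega> v (\<pi> m w)" using N \<open>m \<in> N\<close> by simp
        finally show ?thesis using w[OF v] True \<open>m \<noteq> n\<close> by simp
      qed (use D(5)[OF v \<pi>(2)] in auto)
    qed (simp_all add: linear_0[OF lin(2)] linear_add[OF lin(2)])
  qed
  then have "(\<Sum>m\<in>N. \<pi> m w) = (\<Sum>m\<in>N. if m = n then \<pi> n w else 0)"
    by (intro sum.cong) auto
  also have "\<dots> = (if n \<in> N then \<pi> n w else 0)" using N by simp
  finally have w_eq: "w = (if n \<in> N then \<pi> n w else 0)" by (simp only: \<pi>(4))
  have "subspace (V n)" using D(1) by (simp add: graded_space_def)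
  then have "(if n \<in> N then \<pi> n w else 0) \<in> V n" using \<pi>(2) by (simp add: subspace_0)
  then show ?thesis by (rule ssubst[OF w_eq])
qed

text \<open>Composing with \<open>s\<close> absorbs the sign in the definition of the graded
  adjoint, which reduces it to the ungraded one.\<close>

lemma degree_sign_operator:
  assumes fin: "finite_dimensional (UNIV :: 'a::real_vector set)" and G: "graded_space UNIV V"
  obtains s :: "'a::real_vector \<Rightarrow> 'a" where "linear s" "\<And>n v. v \<in> V n \<Longrightarrow> s v = ((-1) powi n) *\<^sub>R v"
proof -
  obtain N \<pi> where N: "finite N" and \<pi>: "\<And>n. linear (\<pi> n)" "\<And>n v. \<pi> n v \<in> V n"
      "\<And>m n v. v \<in> V n \<Longrightarrow> \<pi> m v = (if m = n then v else 0)" "\<And>v. (\<Sum>n\<in>N. \<pi> n v) = v"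
    using graded_projections[OF fin G] by blast
  define s where "s v = (\<Sum>n\<in>N. ((-1) powi n) *\<^sub>R \<pi> n v)" for v
  have "linear s" unfolding s_def
    by (intro linear_compose_sum ballI linear_compose_scale_right \<pi>(1))
  moreover have "s v = ((-1) powi n) *\<^sub>R v" if v: "v \<in> V n" for n v
  proof -
    have "s v = (\<Sum>m\<in>N. ((-1) powi n) *\<^sub>R \<pi> m v)"
      unfolding s_def using \<pi>(3)[OF v] by (intro sum.cong) auto
    also have "\<dots> = ((-1) powi n) *\<^sub>R (\<Sum>m\<in>N. \<pi> m v)" by (rule scaleR_sum_right[symmetric])
    finally show ?thesis by (simp only: \<pi>(4))
  qed
  ultimately show thesis using that by blast
qed

lemma is_adjoint_minus_one_iff:
  "is_adjoint (-1) V \<omega> S \<omega>' f g \<longleftrightarrow>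
    (\<forall>n. \<forall>v\<in>V n. \<forall>w\<in>S. \<omega>' (f v) w = (-1) powi n * \<omega> v (g w))"
  by (simp add: is_adjoint_def power_int_minus_one_minus)

lemma graded_adjoint_exists:
  assumes fin: "finite_dimensional (UNIV :: 'a::real_vector set)"
    and dg: "dg_shifted_symplectic UNIV V \<omega> (q :: 'a \<Rightarrow> 'a)"
    and h: "linear h" "has_degree (-1) V V h"
  obtains h' where "linear h'" "has_degree (-1) V V h'"
    "is_adjoint (-1) V \<omega> UNIV \<omega> h h'" "is_adjoint (-1) V \<omega> UNIV \<omega> h' h"
proof -
  note D = dg_shifted_symplectic_UNIV_D[OF dg]
  have lin: "linear (\<omega> v)" "linear (\<lambda>v. \<omega> v w)" for v w
    using D(2) by (auto simp: bilinear_def)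
  have hd: "h v \<in> V (n - 1)" if "v \<in> V n" for n v using h(2) that by (auto simp: has_degree_def)
  obtain s where s: "linear s" "\<And>n v. v \<in> V n \<Longrightarrow> s v = ((-1) powi n) *\<^sub>R v"
    using degree_sign_operator[OF fin D(1)] by metis
  obtain h' where h': "linear h'" "\<And>v w. \<omega> ((h \<circ> s) v) w = \<omega> v (h' w)"
    using bilinear_adjoint_exists[OF fin D(2) D(4) linear_compose[OF s(1) h(1)]] by metis
  have adj: "\<omega> (h v) w = (-1) powi n * \<omega> v (h' w)" if "v \<in> V n" for n v w
  proof -
    have "\<omega> v (h' w) = (-1) powi n * \<omega> (h v) w"
      using h'(2)[of v w] s(2)[OF that]
      by (simp add: linear_cmul[OF h(1)] linear_cmul[OF lin(2)])
    then show ?thesis by simp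
  qed
  have hd': "h' w \<in> V (m - 1)" if w: "w \<in> V m" for m w
  proof (rule nondegenerate_homogeneous[OF fin dg])
    show "\<omega> v (h' w) = 0" if "v \<in> V l" "l \<noteq> 1 - (m - 1)" for v l
      using adj[OF that(1), of w] D(5)[OF hd[OF that(1)] w] that(2) by simp
  qed
  have "\<omega> (h' v) w = (-1) powi n * \<omega> v (h w)" if v: "v \<in> V n" for n v w
  proof (rule graded_space_UNIV_induct[OF D(1), of "\<lambda>w. \<omega> (h' v) w = (-1) powi n * \<omega> v (h w)"])
    show "\<omega> (h' v) w = (-1) powi n * \<omega> v (h w)" if w: "w \<in> V m" for m w
    \<comment> \<open>Both pairings vanish unless \<open>m = 2 - n\<close>. Then \<open>m\<close>
      and \<open>n\<close> have equal parity, so the signs agree, and the two minus signs from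
      antisymmetry cancel.\<close>
    proof (cases "m = 2 - n")
      case True
      have "\<omega> v (h w) = (-1) powi m * \<omega> (h' v) w"
        using adj[OF w, of v] D(3)[of v "h w"] D(3)[of "h' v" w] by simp
      then show ?thesis using True by (simp add: power_int_diff)
    next
      case False
      then show ?thesis using D(5)[OF hd'[OF v] w] D(5)[OF v hd[OF w]] by simp
    qed
  qed (simp_all add: linear_0[OF lin(1)] linear_0[OF h(1)] linear_add[OF lin(1)] linear_add[OF h(1)]
        distrib_left)
  then show thesis
    using that h'(1) hd' adj by (simp add: is_adjoint_minus_one_iff has_degree_def)
qed

section \<open>Parametrices: existence and convexity\<close>

lemma cyclic_parametrix_exists:
  assumes fin: "finite_dimensional (UNIV :: 'a::real_vector set)"
    and dg: "dg_shifted_symplectic UNIV V \<omega> (q :: 'a \<Rightarrow> 'a)"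
  obtains h where "linear h" "has_degree (-1) V V h" "is_adjoint (-1) V \<omega> UNIV \<omega> h h"
    "\<And>v. q (h (q v)) = q v"
proof -
  note D = dg_shifted_symplectic_UNIV_D[OF dg]
  have lin: "linear (\<omega> v)" "linear (\<lambda>v. \<omega> v w)" for v w
    using D(2) by (auto simp: bilinear_def)
  have sub: "subspace (V n)" for n using D(1) by (simp add: graded_space_def)
  have "has_degree 1 V V q" using D(8) by (simp add: has_degree_def)
  then obtain h where h: "linear h" "has_degree (-1) V V h" "\<And>v. q (h (q v)) = q v"
    using graded_right_inverse[OF fin D(1) D(6)] by metis
  obtain h' where h': "linear h'" "has_degree (-1) V V h'"
      "is_adjoint (-1) V \<omega> UNIV \<omega> h h'" "is_adjoint (-1) V \<omega> UNIV \<omega> h' h"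
    using graded_adjoint_exists[OF fin dg h(1,2)] .
  have adj: "\<omega> (h v) w = (-1) powi n * \<omega> v (h' w)"
    "\<omega> (h' v) w = (-1) powi n * \<omega> v (h w)" if "v \<in> V n" for n v w
    using h'(3,4) that by (simp_all add: is_adjoint_minus_one_iff)
  have hd: "h (q v) \<in> V n" if "v \<in> V n" for n v
    using h(2) D(8)[OF that] by (force simp: has_degree_def)
  \<comment> \<open>Tested against homogeneous \<open>v\<close>: moving \<open>q\<close>,
    \<open>h'\<close> and \<open>q\<close> across the pairing turns the left side into
    \<open>q h q = q\<close> acting on \<open>v\<close>. Thus the adjoint is again a generalized
    inverse, and so is the average.\<close>
  have qh'q: "q (h' (q w)) = q w" for w
  proof -
    have "\<omega> v (q (h' (q w)) - q w) = 0" for v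
    proof (rule graded_space_UNIV_induct[OF D(1), of "\<lambda>v. \<omega> v (q (h' (q w)) - q w) = 0"])
      fix n v assume v: "v \<in> V n"
      have "\<omega> v (q (h' (q w))) = \<omega> (h (q v)) (q w)"
        using D(9)[OF v, of "h' (q w)"] adj(1)[OF D(8)[OF v], of "q w"] by (simp add: power_int_add)
      also have "\<dots> = \<omega> v (q w)"
        using D(9)[OF hd[OF v], of w] D(9)[OF v, of w] h(3)[of v] by simp
      finally show "\<omega> v (q (h' (q w)) - q w) = 0" by (simp add: linear_diff[OF lin(1)])
    qed (simp_all add: linear_0[OF lin(2)] linear_add[OF lin(2)])
    then show ?thesis using D(4)[of "q (h' (q w)) - q w"] by simp
  qed
  show thesis
  proof (rule that)
    let ?k = "\<lambda>v. (1/2) *\<^sub>R (h v + h' v)"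
    show "linear ?k" by (intro linear_compose_scale_right linear_compose_add h(1) h'(1))
    show "has_degree (-1) V V ?k"
      using h(2) h'(2) by (auto simp: has_degree_def intro!: subspace_scale[OF sub] subspace_add[OF sub])
    show "is_adjoint (-1) V \<omega> UNIV \<omega> ?k ?k"
      by (simp add: is_adjoint_minus_one_iff adj linear_add[OF lin(1)] linear_add[OF lin(2)]
          linear_cmul[OF lin(1)] linear_cmul[OF lin(2)] algebra_simps)
    show "q (?k (q v)) = q v" for v
      by (simp add: linear_cmul[OF D(6)] linear_add[OF D(6)] h(3) qh'q scaleR_2[symmetric])
  qed
qed

text \<open>The set called \<open>P\<close> in the overview; linearity is part of the operator
  type.\<close>

definition cyclic_parametrices ::
  "(int \<Rightarrow> 'a::real_normed_vector set) \<Rightarrow> ('a \<Rightarrow> 'a \<Rightarrow> real) \<Rightarrow> ('a \<Rightarrow> 'a) \<Rightarrow> ('a \<Rightarrow>\<^sub>L 'a) set" where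
  "cyclic_parametrices V \<omega> q =
     {h. has_degree (-1) V V (blinfun_apply h) \<and>
         is_adjoint (-1) V \<omega> UNIV \<omega> (blinfun_apply h) (blinfun_apply h) \<and>
         (\<forall>v. q (blinfun_apply h (q v)) = q v)}"

text \<open>Degree and self-adjointness are linear conditions; \<open>s + t = 1\<close> enters only
  through the inhomogeneous equation \<open>qhq = q\<close>.\<close>

lemma convex_cyclic_parametrices:
  assumes dg: "dg_shifted_symplectic UNIV V \<omega> q"
  shows "convex (cyclic_parametrices V \<omega> q)"
proof (rule convexI)
  note D = dg_shifted_symplectic_UNIV_D[OF dg]
  have lin: "linear (\<omega> v)" "linear (\<lambda>v. \<omega> v w)" for v w
    using D(2) by (auto simp: bilinear_def)
  have sub: "subspace (V n)" for n using D(1) by (simp add: graded_space_def)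
  fix h k and s t :: real
  assume hk: "h \<in> cyclic_parametrices V \<omega> q" "k \<in> cyclic_parametrices V \<omega> q" and "s + t = 1"
  then have "q (s *\<^sub>R h (q v) + t *\<^sub>R k (q v)) = q v" for v
    by (simp add: cyclic_parametrices_def linear_cmul[OF D(6)] linear_add[OF D(6)]
        scaleR_add_left[symmetric])
  then show "s *\<^sub>R h + t *\<^sub>R k \<in> cyclic_parametrices V \<omega> q"
    using hk by (auto simp: cyclic_parametrices_def has_degree_def is_adjoint_minus_one_iff
        blinfun.add_left blinfun.scaleR_left linear_add[OF lin(1)] linear_add[OF lin(2)]
        linear_cmul[OF lin(1)] linear_cmul[OF lin(2)] algebra_simps
        intro!: subspace_scale[OF sub] subspace_add[OF sub])
qed

text \<open>
  Replacing \<open>h\<close> by \<open>k = hqh\<close> gives \<open>kqk = k\<close>. Both \<open>k(1 - kq)\<close> and \<open>(1 - qk)k\<close> have square zero but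
  are not self-adjoint; since \<open>qk\<close> and \<open>kq\<close> are adjoint, half of each correction is
  self-adjoint, and its square vanishes because
  \<open>k(1 - kq/2)(1 - qk/2)k = k\<^sup>2 - k\<^sup>2/2 - k\<^sup>2/2\<close>.
\<close>

definition cyclic_correction :: "('a::real_normed_vector \<Rightarrow>\<^sub>L 'a) \<Rightarrow> ('a \<Rightarrow>\<^sub>L 'a) \<Rightarrow> 'a \<Rightarrow>\<^sub>L 'a" where
  "cyclic_correction Q h =
     (let k = h o\<^sub>L Q o\<^sub>L h in
       (id_blinfun - (1/2) *\<^sub>R (Q o\<^sub>L k)) o\<^sub>L k o\<^sub>L (id_blinfun - (1/2) *\<^sub>R (k o\<^sub>L Q)))"

section \<open>The retraction onto homotopy operators\<close>

lemma continuous_on_cyclic_correction: "continuous_on A (cyclic_correction Q)"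
  unfolding cyclic_correction_def Let_def by (intro continuous_intros)

text \<open>Here \<open>k Q k\<close> is \<open>k\<close> itself, and each correction term contains
  \<open>k\<close> applied twice in succession.\<close>

lemma cyclic_correction_fixes:
  fixes Q k :: "'a::real_normed_vector \<Rightarrow>\<^sub>L 'a"
  assumes "\<And>v. k (k v) = 0" "\<And>v. k (Q (k v)) = k v"
  shows "cyclic_correction Q k = k"
  by (rule blinfun_eqI)
    (simp add: cyclic_correction_def Let_def assms blinfun.diff_left blinfun.scaleR_left
      blinfun.diff_right blinfun.scaleR_right)

lemma cyclic_correction_in_retracts:
  assumes dg: "dg_shifted_symplectic UNIV V \<omega> (blinfun_apply Q)"
    and h: "h \<in> cyclic_parametrices V \<omega> (blinfun_apply Q)"
  shows "cyclic_correction Q h \<in> strict_cohomology_retracts V \<omega> (blinfun_apply Q)"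
proof -
  note D = dg_shifted_symplectic_UNIV_D[OF dg]
  have lin: "linear (\<omega> v)" "linear (\<lambda>v. \<omega> v w)" for v w
    using D(2) by (auto simp: bilinear_def)
  have sub: "subspace (V n)" for n using D(1) by (simp add: graded_space_def)
  have h: "\<And>n v. v \<in> V n \<Longrightarrow> h v \<in> V (n - 1)"
    "\<And>n v w. v \<in> V n \<Longrightarrow> \<omega> (h v) w = (-1) powi n * \<omega> v (h w)" "\<And>v. Q (h (Q v)) = Q v"
    using h by (auto simp: cyclic_parametrices_def has_degree_def is_adjoint_minus_one_iff)
  \<comment> \<open>For a self-adjoint \<open>f\<close> of degree -1 the signs from moving
    \<open>Q\<close> and \<open>f\<close> cancel, so \<open>Q f\<close> and \<open>f Q\<close> are
    adjoint without a sign. This is used for both \<open>h\<close> and \<open>k\<close>.\<close>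
  have Qh: "\<omega> (Q (f v)) w = \<omega> v (f (Q w))" and hQ: "\<omega> (f (Q v)) w = \<omega> v (Q (f w))"
    if v: "v \<in> V n" and fd: "\<And>n v. v \<in> V n \<Longrightarrow> f v \<in> V (n - 1)"
      and f: "\<And>n v w. v \<in> V n \<Longrightarrow> \<omega> (f v) w = (-1) powi n * \<omega> v (f w)" for f n v w
    using D(9)[OF fd[OF v], of w] f[OF v, of "Q w"] f[OF D(8)[OF v], of w] D(9)[OF v, of "f w"]
    by (simp_all add: power_int_add power_int_diff)
  have Qhd: "Q (f v) \<in> V n" "f (Q v) \<in> V n"
    if v: "v \<in> V n" and fd: "\<And>n v. v \<in> V n \<Longrightarrow> f v \<in> V (n - 1)" for f n v
    using D(8)[OF fd[OF v]] fd[OF D(8)[OF v]] by simp_all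
  define k where "k = h o\<^sub>L Q o\<^sub>L h"
  have kd: "k v \<in> V (n - 1)" if "v \<in> V n" for n v
    using h(1)[OF Qhd(1)[where f = h, OF that h(1)]] by (simp add: k_def)
  have k: "\<omega> (k v) w = (-1) powi n * \<omega> v (k w)" if "v \<in> V n" for n v w
    using h(2)[OF Qhd(1)[where f = h, OF that h(1)], of w] Qh[where f = h and w = "h w", OF that h(1,2)] by (simp add: k_def)
  have kQk: "k (Q (k v)) = k v" and QkQ: "Q (k (Q v)) = Q v" for v
    by (simp_all add: k_def h(3))
  define a where "a v = v - (1/2) *\<^sub>R Q (k v)" for v
  define b where "b v = v - (1/2) *\<^sub>R k (Q v)" for v
  have c: "cyclic_correction Q h v = a (k (b v))" for v
    by (simp add: cyclic_correction_def k_def[symmetric] Let_def a_def b_def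
        blinfun.diff_left blinfun.scaleR_left)
  note bl = blinfun.diff_right blinfun.scaleR_right
  \<comment> \<open>The outer factors \<open>a\<close> and \<open>b\<close> are adjoint to each
    other, so \<open>a k b\<close> inherits self-adjointness from \<open>k\<close>.\<close>
  have ab: "\<omega> (a v) w = \<omega> v (b w)" and ba: "\<omega> (b v) w = \<omega> v (a w)" if "v \<in> V n" for n v w
    using Qh[where f = k and w = w, OF that kd k] hQ[where f = k and w = w, OF that kd k]
    by (simp_all add: a_def b_def linear_diff[OF lin(1)] linear_diff[OF lin(2)]
        linear_cmul[OF lin(1)] linear_cmul[OF lin(2)])
  have ad: "a v \<in> V n" and bd: "b v \<in> V n" if "v \<in> V n" for n v
    using Qhd[where f = k, OF that kd] that
    by (auto simp: a_def b_def intro!: subspace_scale[OF sub] subspace_diff[OF sub])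
  have "\<omega> (a (k (b v))) w = (-1) powi n * \<omega> v (a (k (b w)))" if v: "v \<in> V n" for n v w
    using ab[OF kd[OF bd[OF v]], of w] k[OF bd[OF v], of "b w"] ba[OF v, of "k (b w)"] by simp
  moreover have "a (k (b v)) \<in> V (n - 1)" if v: "v \<in> V n" for n v
    using ad[OF kd[OF bd[OF v]]] .
  \<comment> \<open>The remaining term of the expansion contains \<open>Q\<close> twice in
    succession and vanishes by \<open>D(7)\<close>.\<close>
  moreover have "k (b (a (k v))) = 0" for v
    by (simp add: a_def b_def bl blinfun.add_right kQk D(7) algebra_simps)
      (simp flip: scaleR_add_left)
  \<comment> \<open>Next to \<open>Q\<close> the outer factors disappear. Hence
    \<open>(a k b) Q (a k b) = a k Q k b = a k b\<close> and
    \<open>Q (a k b) Q = Q k Q = Q\<close>.\<close>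
  moreover have bQ: "b (Q v) = Q v" and Qa: "Q (a v) = Q v" for v
    by (simp_all add: a_def b_def bl D(7))
  moreover have "a 0 = 0" by (simp add: a_def)
  ultimately show ?thesis
    unfolding strict_cohomology_retracts_eq[OF dg]
    by (simp add: has_degree_def is_adjoint_minus_one_iff c kQk QkQ)
qed

theorem theorem5p4:
  fixes V :: "int \<Rightarrow> 'a::real_normed_vector set"
    and \<omega> :: "'a \<Rightarrow> 'a \<Rightarrow> real"
    and q :: "'a \<Rightarrow> 'a"
  assumes "finite_dimensional (UNIV :: 'a set)"
    and "dg_shifted_symplectic UNIV V \<omega> q"
  shows "strict_cohomology_retracts V \<omega> q \<noteq> {} \<and> contractible (strict_cohomology_retracts V \<omega> q)"
proof -
  note fin = assms(1) and dg = assms(2)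
  let ?R = "strict_cohomology_retracts V \<omega> q" and ?P = "cyclic_parametrices V \<omega> q"
  define Q where "Q = Blinfun q"
  have q: "q = blinfun_apply Q"
    using linear_finite_dimensional_bounded_linear[OF fin dg_shifted_symplectic_UNIV_D(6)[OF dg]]
    by (simp add: Q_def bounded_linear_Blinfun_apply)
  have corr: "cyclic_correction Q h \<in> ?R" if "h \<in> ?P" for h
    using cyclic_correction_in_retracts[of V \<omega> Q h] dg that unfolding q by blast
  obtain h where h: "linear h" "has_degree (-1) V V h" "is_adjoint (-1) V \<omega> UNIV \<omega> h h"
      "\<And>v. q (h (q v)) = q v"
    using cyclic_parametrix_exists[OF fin dg] by blast
  have "Blinfun h \<in> ?P"
    using h by (simp add: cyclic_parametrices_def
        bounded_linear_Blinfun_apply[OF linear_finite_dimensional_bounded_linear[OF fin h(1)]])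
  \<comment> \<open>Needs its own argument, since the empty set also counts as contractible:
    correcting any parametrix gives a point.\<close>
  then have "?R \<noteq> {}" using corr by blast
  moreover have "retraction ?P ?R (cyclic_correction Q)"
    unfolding retraction_def
  proof (intro conjI ballI)
    show "?R \<subseteq> ?P" by (auto simp: strict_cohomology_retracts_eq[OF dg] cyclic_parametrices_def)
    show "cyclic_correction Q k = k" if "k \<in> ?R" for k
      using that by (intro cyclic_correction_fixes) (auto simp: strict_cohomology_retracts_eq[OF dg] q[symmetric])
  qed (use corr continuous_on_cyclic_correction in auto)
  then have "contractible ?R"
    using retract_of_contractible[OF convex_imp_contractible[OF convex_cyclic_parametrices[OF dg]]]
    unfolding retract_of_def by blast
  ultimately show ?thesis by blast
qed

end
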